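(* For every $S\in\mathbb{C}$ there are at most three pairs $(c,O)$ such that $c\in\mathbb{C}$, $O=\{x_0,x_1,x_2,x_3,x_4\}\subset\mathbb{C}$ is a period five cycle of $f_c$, and $x_0+x_1+x_2+x_3+x_4=S$. In other words, any given value of the sum of period five cycle points is attained by at most three period five cycles of the quadratic family $(f_c)_{c\in\mathbb{C}}$.
   Context: For $c\in\mathbb{C}$ let $f_c:\mathbb{C}\to\mathbb{C}$, $f_c(x)=x^2+c$. A period five cycle of $f_c$ is a set of five distinct points $\{x_0,x_1,x_2,x_3,x_4\}$ with $x_{i+1}=f_c(x_i)$ for $0\le i\le 3$ and $f_c(x_4)=x_0$ (that is, an orbit of exact period $5$). Two pairs $(c,O)$ and $(c',O')$ are the same if and only if $c=c'$ and $O=O'$ as sets. *)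

theory Defs
  imports Complex_Main
begin

definition quad :: "complex \<Rightarrow> complex \<Rightarrow> complex" where
  "quad c x = x\<^sup>2 + c"

text \<open>Cycles are unordered sets, so the choice of the starting point is immaterial.\<close>

definition period_five_cycle :: "complex \<Rightarrow> complex set \<Rightarrow> bool" where
  "period_five_cycle c X \<longleftrightarrow>
     (\<exists>x0 x1 x2 x3 x4. X = {x0, x1, x2, x3, x4} \<and> distinct [x0, x1, x2, x3, x4] \<and>
        x1 = quad c x0 \<and> x2 = quad c x1 \<and> x3 = quad c x2 \<and> x4 = quad c x3 \<and> quad c x4 = x0)"

end

theory Submission
  imports Defs
begin

text \<open>
  Put \<open>A = \<Sum>x\<^sub>i x\<^sub>i\<^sub>+\<^sub>1\<close>. The ring of functions on the curve of pairs (parameter, period five cycle)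
  is generated by \<open>1, c, A\<close> as a module over the polynomials in the trace \<open>S\<close>: every
  elementary symmetric function of the cycle is a polynomial in \<open>S, c, A\<close>, and the products
  \<open>c\<^sup>2, c A, A\<^sup>2\<close> are combinations of \<open>1, c, A\<close> with coefficients polynomial in \<open>S\<close>.
  Hence the cycles with a given \<open>S\<close> inject into a plane set, via \<open>(c, A)\<close>, on which the affine
  functions are closed under multiplication. Affine functions separate points and span a space of
  dimension 3, so such a set has at most three points.
\<close>

text \<open>Since 5 is prime, a solution of \<open>step\<close> with \<open>x0 \<noteq> x1\<close>
  has exact period five: the inequality excludes just the fixed points.\<close>

locale five_cycle =
  fixes c x0 x1 x2 x3 x4 :: complex
  assumes step: "x0\<^sup>2 = x1 - c" "x1\<^sup>2 = x2 - c" "x2\<^sup>2 = x3 - c" "x3\<^sup>2 = x4 - c" "x4\<^sup>2 = x0 - c"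
    and x0_neq_x1: "x0 \<noteq> x1"
begin

text \<open>The sums over the orbits of the cyclic shift on squarefree monomials,
  together with 1, span the shift-invariant polynomials modulo \<open>step\<close> over the
  polynomials in \<open>c\<close>.\<close>

definition "S = x0 + x1 + x2 + x3 + x4"
definition "A = x0*x1 + x1*x2 + x2*x3 + x3*x4 + x4*x0"
definition "B = x0*x2 + x1*x3 + x2*x4 + x3*x0 + x4*x1"
definition "C = x0*x1*x2 + x1*x2*x3 + x2*x3*x4 + x3*x4*x0 + x4*x0*x1"
definition "E = x0*x1*x3 + x1*x2*x4 + x2*x3*x0 + x3*x4*x1 + x4*x0*x2"
definition "F = x0*x1*x2*x3 + x1*x2*x3*x4 + x2*x3*x4*x0 + x3*x4*x0*x1 + x4*x0*x1*x2"
definition "N = x0*x1*x2*x3*x4"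

lemmas orbit_sum_defs = S_def A_def B_def C_def E_def F_def N_def

text \<open>Multiplication table: expanding the products and repeatedly replacing squares by
  \<open>step\<close> leaves combinations of orbit sums.\<close>

lemma S_S: "S*S = S - 5*c + 2*A + 2*B"
  using step unfolding orbit_sum_defs by algebra

lemma S_A: "S*A = S - 5*c - 2*c*S + B + 2*C + E"
  using step unfolding orbit_sum_defs by algebra

lemma S_B: "S*B = A + B - 2*c*S + C + 2*E"
  using step unfolding orbit_sum_defs by algebra

lemma S_C: "S*C = S - 5*c - 2*c*S - 2*c*A + B - c*B + E + 2*F"
  using step unfolding orbit_sum_defs by algebra

lemma S_E: "S*E = A - c*S - c*A - 2*c*B + C + E + 2*F"
  using step unfolding orbit_sum_defs by algebra

lemma S_F: "S*F = S - 5*c - 2*c*S + A - 2*c*A - c*B + C - 2*c*C - 2*c*E + F + 5*N"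
  using step unfolding orbit_sum_defs by algebra

lemma A_A: "A*A = 5*c\<^sup>2 - 4*c*S + A + 2*B - 2*c*B + 2*F"
  using step unfolding orbit_sum_defs by algebra

text \<open>Multiplying by \<open>x0 - x1\<close> excludes the fixed points of \<open>quad c\<close>, which satisfy
  the equations \<open>step\<close> but not the relation below.\<close>

lemma F_eq: "F = - 1 + 3*c - c\<^sup>2 - S + 2*c*S - A + c*A - B + c*B - C - E"
proof -
  have "(x0 - x1) * (F + 1 - 3*c + c\<^sup>2 + S - 2*c*S + A - c*A + B - c*B + C + E) = 0"
    using step unfolding orbit_sum_defs by algebra
  then show ?thesis
    using x0_neq_x1 by algebra
qed

text \<open>\<open>S_S\<close>, \<open>S_A\<close>, \<open>S_B\<close> and \<open>F_eq\<close>
  express \<open>B\<close>, \<open>C\<close>, \<open>E\<close>, \<open>F\<close> through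
  \<open>S\<close>, \<open>c\<close>, \<open>A\<close>. Then \<open>S_C\<close> and
  \<open>S_E\<close> become two independent equations, linear in \<open>c\<^sup>2\<close> and
  \<open>c*A\<close>; solving them gives this relation and the next.\<close>

lemma c_c: "9*c\<^sup>2 = - (24 + 6*S + 3*S^2 - 2*S^3 + S^4) - (18 - 2*S + 10*S^2)*c - 8*(1 + S)*A"
  using S_S S_A S_B S_C S_E F_eq by algebra

lemma c_A: "9*c*A = - (30 + 3*S - 3*S^2 - S^3 - S^4) - (45 + 26*S - S^2)*c - (22 + 19*S + 9*S^2)*A"
  using S_S S_A S_B S_C S_E F_eq by algebra

lemma A_A_reduced: "9*A\<^sup>2 = - (150 + 42*S - 6*S^2 - 5*S^3 + S^4) - (90 + 85*S + 28*S^2)*c - (83 + 62*S + 18*S^2)*A"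
  using S_S S_A S_B S_C S_E F_eq A_A by algebra

lemma poly_factored:
  "(t - x0) * (t - x1) * (t - x2) * (t - x3) * (t - x4) =
    t^5 - S*t^4 + (A + B)*t^3 - (C + E)*t\<^sup>2 + F*t - N"
  unfolding orbit_sum_defs by algebra

lemma B_reduced: "B = (S*S - S + 5*c - 2*A) / 2"
  using S_S by (simp add: field_simps)

text \<open>Twice \<open>S_B\<close> minus \<open>S_A\<close> eliminates \<open>C\<close>.\<close>

lemma E_reduced: "E = (2*(S*B - A - B + 2*c*S) - (S*A - S + 5*c + 2*c*S - B)) / 3"
  using S_A S_B by (simp add: field_simps)

lemma C_reduced: "C = S*B - A - B + 2*c*S - 2*E"
  using S_B by algebra

lemma N_reduced: "N = (S*F - (S - 5*c - 2*c*S + A - 2*c*A - c*B + C - 2*c*C - 2*c*E + F)) / 5"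
  using S_F by (simp add: field_simps)

end

text \<open>Given \<open>c\<close>, \<open>S\<close> and \<open>A\<close>, the values of
  \<open>B\<close>, \<open>E\<close>, \<open>C\<close>, \<open>F\<close>, \<open>N\<close> are
  determined in this order, so both sets are the roots of the same quintic.\<close>

lemma five_cycle_orbit_sums_eq:
  assumes "five_cycle c x0 x1 x2 x3 x4" "five_cycle c y0 y1 y2 y3 y4"
    and S: "five_cycle.S x0 x1 x2 x3 x4 = five_cycle.S y0 y1 y2 y3 y4"
    and A: "five_cycle.A x0 x1 x2 x3 x4 = five_cycle.A y0 y1 y2 y3 y4"
  shows "{x0, x1, x2, x3, x4} = {y0, y1, y2, y3, y4}"
proof -
  interpret x: five_cycle c x0 x1 x2 x3 x4 by fact
  interpret y: five_cycle c y0 y1 y2 y3 y4 by fact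
  have B: "x.B = y.B"
    by (simp only: x.B_reduced y.B_reduced S A)
  have E: "x.E = y.E"
    by (simp only: x.E_reduced y.E_reduced S A B)
  have C: "x.C = y.C"
    by (simp only: x.C_reduced y.C_reduced S A B E)
  have F: "x.F = y.F"
    by (simp only: x.F_eq y.F_eq S A B C E)
  have N: "x.N = y.N"
    by (simp only: x.N_reduced y.N_reduced S A B C E F)
  have "(t - x0) * (t - x1) * (t - x2) * (t - x3) * (t - x4) = 0 \<longleftrightarrow>
      (t - y0) * (t - y1) * (t - y2) * (t - y3) * (t - y4) = 0" for t
    by (simp only: x.poly_factored y.poly_factored S A B C E F N)
  then have "t \<in> {x0, x1, x2, x3, x4} \<longleftrightarrow> t \<in> {y0, y1, y2, y3, y4}" for t
    by simp
  then show ?thesis by blast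
qed

text \<open>The functions on \<open>P\<close> induced by affine functions form an algebra of dimension at most 3,
  and they separate points.\<close>

lemma card_le_3_if_quadratics_affine:
  fixes P :: "('a::field \<times> 'a) set"
  assumes "\<And>x y. (x, y) \<in> P \<Longrightarrow> x * x = a0 + a1*x + a2*y"
    and "\<And>x y. (x, y) \<in> P \<Longrightarrow> x * y = b0 + b1*x + b2*y"
    and "\<And>x y. (x, y) \<in> P \<Longrightarrow> y * y = d0 + d1*x + d2*y"
  shows "finite P \<and> card P \<le> 3"
proof (rule ccontr)
  define aff :: "('a \<times> 'a \<Rightarrow> 'a) \<Rightarrow> bool"
    where "aff f \<longleftrightarrow> (\<exists>p q r. \<forall>x y. f (x, y) = p + q*x + r*y)" for f
  have mult: "\<exists>h. aff h \<and> (\<forall>z\<in>P. h z = f z * g z)" if "aff f" "aff g" for f g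
  proof -
    obtain p q r where f: "\<And>x y. f (x, y) = p + q*x + r*y"
      using \<open>aff f\<close> unfolding aff_def by blast
    obtain p' q' r' where g: "\<And>x y. g (x, y) = p' + q'*x + r'*y"
      using \<open>aff g\<close> unfolding aff_def by blast
    define h where "h = (\<lambda>(x, y).
      (p*p' + q*q'*a0 + (q*r' + r*q')*b0 + r*r'*d0) +
      (p*q' + q*p' + q*q'*a1 + (q*r' + r*q')*b1 + r*r'*d1) * x +
      (p*r' + r*p' + q*q'*a2 + (q*r' + r*q')*b2 + r*r'*d2) * y)"
    have "aff h"
      unfolding aff_def h_def by auto
    moreover have "h (x, y) = f (x, y) * g (x, y)" if "(x, y) \<in> P" for x y
      unfolding f g h_def prod.case
      using assms(1-3)[OF that] by algebra
    ultimately show ?thesis by (auto intro!: exI[of _ h])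
  qed
  have sep: "\<exists>f. aff f \<and> f u \<noteq> 0 \<and> f v = 0" if "u \<noteq> v" for u v
  proof (cases "fst u = fst v")
    case True
    have "aff (\<lambda>z. snd z - snd v)"
      unfolding aff_def by (intro exI[of _ "- snd v"] exI[of _ 0] exI[of _ 1]) simp
    moreover have "snd u - snd v \<noteq> 0"
      using that True by (simp add: prod_eq_iff)
    ultimately show ?thesis
      by (intro exI[of _ "\<lambda>z. snd z - snd v"]) simp
  next
    case False
    have "aff (\<lambda>z. fst z - fst v)"
      unfolding aff_def by (intro exI[of _ "- fst v"] exI[of _ 1] exI[of _ 0]) simp
    then show ?thesis
      using False by (intro exI[of _ "\<lambda>z. fst z - fst v"]) simp
  qed
  \<comment> \<open>Multiply affine functions separating \<open>t\<close> from each of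
    \<open>u\<close>, \<open>v\<close>, \<open>w\<close>; on \<open>P\<close> the product is again
    affine.\<close>
  have sep3: "\<exists>f. aff f \<and> f t \<noteq> 0 \<and> f u = 0 \<and> f v = 0 \<and> f w = 0"
    if "t \<in> P" "u \<in> P" "v \<in> P" "w \<in> P" "t \<noteq> u" "t \<noteq> v" "t \<noteq> w" for t u v w
  proof -
    obtain fu where fu: "aff fu" "fu t \<noteq> 0" "fu u = 0"
      using sep \<open>t \<noteq> u\<close> by blast
    obtain fv where fv: "aff fv" "fv t \<noteq> 0" "fv v = 0"
      using sep \<open>t \<noteq> v\<close> by blast
    obtain fw where fw: "aff fw" "fw t \<noteq> 0" "fw w = 0"
      using sep \<open>t \<noteq> w\<close> by blast
    obtain g where g: "aff g" "\<forall>z\<in>P. g z = fu z * fv z"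
      using mult[OF fu(1) fv(1)] by blast
    obtain h where "aff h" "\<forall>z\<in>P. h z = g z * fw z"
      using mult[OF g(1) fw(1)] by blast
    then show ?thesis
      using fu fv fw g that by (intro exI[of _ h]) simp
  qed
  assume "\<not> (finite P \<and> card P \<le> 3)"
  then obtain Q where Q: "Q \<subseteq> P" "card Q = 4"
    using infinite_arbitrarily_large[of P 4] obtain_subset_with_card_n[of 4 P] by force
  then have "finite Q"
    by (simp add: card_ge_0_finite)
  then obtain xs where "set xs = Q" "distinct xs"
    using finite_distinct_list by blast
  moreover from this have "length xs = Suc (Suc (Suc (Suc 0)))"
    using Q distinct_card[of xs] by simp
  ultimately obtain s t u v where "Q = {s, t, u, v}" and distinct: "distinct [s, t, u, v]"
    by (auto simp: length_Suc_conv)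
  then have in_P: "s \<in> P" "t \<in> P" "u \<in> P" "v \<in> P"
    using Q by auto
  obtain f where f: "aff f" "f s \<noteq> 0" "f t = 0" "f u = 0" "f v = 0"
    using sep3[of s t u v] in_P distinct by auto
  obtain g where g: "aff g" "g v \<noteq> 0" "g s = 0" "g t = 0" "g u = 0"
    using sep3[of v s t u] in_P distinct by auto
  obtain p q r where f_eq: "\<And>x y. f (x, y) = p + q*x + r*y"
    using \<open>aff f\<close> unfolding aff_def by blast
  obtain p' q' r' where g_eq: "\<And>x y. g (x, y) = p' + q'*x + r'*y"
    using \<open>aff g\<close> unfolding aff_def by blast
  obtain t1 t2 u1 u2 where tu: "t = (t1, t2)" "u = (u1, u2)"
    by fastforce
  \<comment> \<open>Both \<open>f\<close> and \<open>g\<close> vanish at the distinct points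
    \<open>t\<close> and \<open>u\<close>, so their linear parts are proportional.\<close>
  have "(q*r' - r*q') * (t1 - u1) = 0" "(q*r' - r*q') * (t2 - u2) = 0"
    using f(3,4) g(4,5) unfolding tu f_eq g_eq by algebra+
  then have det: "q*r' = r*q'"
    using distinct tu by auto
  obtain s1 s2 v1 v2 where sv: "s = (s1, s2)" "v = (v1, v2)"
    by fastforce
  \<comment> \<open>As \<open>f\<close> and \<open>g\<close> also vanish at the common point
    \<open>t\<close>, proportionality gives \<open>f s * g v = f v * g s\<close>.\<close>
  have "f s * g v = 0"
    using f(3,5) g(3,4) det unfolding tu sv f_eq g_eq by algebra
  then show False
    using f g by simp
qed

lemma period_five_cycle_five_cycle:
  assumes "period_five_cycle c X"
  obtains x0 x1 x2 x3 x4 where "X = {x0, x1, x2, x3, x4}" "five_cycle c x0 x1 x2 x3 x4"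
    "(\<Sum>x\<in>X. x) = five_cycle.S x0 x1 x2 x3 x4"
    "(\<Sum>x\<in>X. x * quad c x) = five_cycle.A x0 x1 x2 x3 x4"
proof -
  obtain x0 x1 x2 x3 x4 where X: "X = {x0, x1, x2, x3, x4}"
    and d: "distinct [x0, x1, x2, x3, x4]"
    and q: "x1 = quad c x0" "x2 = quad c x1" "x3 = quad c x2" "x4 = quad c x3" "quad c x4 = x0"
    using assms unfolding period_five_cycle_def by blast
  have cyc: "five_cycle c x0 x1 x2 x3 x4"
    using d q by unfold_locales (auto simp: quad_def algebra_simps)
  moreover have "(\<Sum>x\<in>X. x) = five_cycle.S x0 x1 x2 x3 x4"
    using d unfolding X five_cycle.S_def[OF cyc] by (simp add: algebra_simps)
  moreover have "(\<Sum>x\<in>X. x * quad c x) = five_cycle.A x0 x1 x2 x3 x4"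
    using d unfolding X five_cycle.A_def[OF cyc] by (simp add: q(5) q(1-4)[symmetric] algebra_simps)
  ultimately show ?thesis
    using that X by blast
qed

theorem theorem3p2:
  fixes S :: complex
  shows "finite {(c, X). period_five_cycle c X \<and> (\<Sum>x\<in>X. x) = S} \<and>
         card {(c, X). period_five_cycle c X \<and> (\<Sum>x\<in>X. x) = S} \<le> 3"
proof -
  let ?Z = "{(c, X). period_five_cycle c X \<and> (\<Sum>x\<in>X. x) = S}"
  \<comment> \<open>On a cycle \<open>quad c x\<close> is the successor of \<open>x\<close>, so the
    second component is \<open>A\<close>, written without choosing a starting point.\<close>
  define \<phi> where "\<phi> = (\<lambda>(c, X). (c, \<Sum>x\<in>X. x * quad c x))"
  have inj: "inj_on \<phi> ?Z"
  proof (rule inj_onI, clarify)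
    fix c X d Y
    assume X: "period_five_cycle c X" and Y: "period_five_cycle d Y"
      and sum_eq: "\<Sum>Y = \<Sum>X" and "\<phi> (c, X) = \<phi> (d, Y)"
    then have eq: "d = c" "(\<Sum>x\<in>X. x * quad c x) = (\<Sum>x\<in>Y. x * quad c x)"
      by (auto simp: \<phi>_def)
    show "c = d \<and> X = Y"
    proof (rule period_five_cycle_five_cycle[OF X], rule period_five_cycle_five_cycle[OF Y])
      fix x0 x1 x2 x3 x4 y0 y1 y2 y3 y4
      assume "X = {x0, x1, x2, x3, x4}" "five_cycle c x0 x1 x2 x3 x4"
        "\<Sum>X = five_cycle.S x0 x1 x2 x3 x4"
        "(\<Sum>x\<in>X. x * quad c x) = five_cycle.A x0 x1 x2 x3 x4"
        "Y = {y0, y1, y2, y3, y4}" "five_cycle d y0 y1 y2 y3 y4"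
        "\<Sum>Y = five_cycle.S y0 y1 y2 y3 y4"
        "(\<Sum>x\<in>Y. x * quad d x) = five_cycle.A y0 y1 y2 y3 y4"
      then show "c = d \<and> X = Y"
        using five_cycle_orbit_sums_eq[of c x0 x1 x2 x3 x4 y0 y1 y2 y3 y4] sum_eq eq by simp
    qed
  qed
  have rels: "c * c = - (24 + 6*S + 3*S^2 - 2*S^3 + S^4) / 9 + (- (18 - 2*S + 10*S^2) / 9) * c
        + (- 8*(1 + S) / 9) * a" (is ?cc)
      "c * a = - (30 + 3*S - 3*S^2 - S^3 - S^4) / 9 + (- (45 + 26*S - S^2) / 9) * c
        + (- (22 + 19*S + 9*S^2) / 9) * a" (is ?ca)
      "a * a = - (150 + 42*S - 6*S^2 - 5*S^3 + S^4) / 9 + (- (90 + 85*S + 28*S^2) / 9) * c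
        + (- (83 + 62*S + 18*S^2) / 9) * a" (is ?aa)
    if ca: "(c, a) \<in> \<phi> ` ?Z" for c a
  proof -
    obtain X where X: "period_five_cycle c X" "(\<Sum>x\<in>X. x) = S" "a = (\<Sum>x\<in>X. x * quad c x)"
      using ca by (auto simp: \<phi>_def)
    obtain x0 x1 x2 x3 x4 where "five_cycle c x0 x1 x2 x3 x4"
      and S: "S = five_cycle.S x0 x1 x2 x3 x4" and a: "a = five_cycle.A x0 x1 x2 x3 x4"
      using period_five_cycle_five_cycle[OF X(1)] X(2,3) by metis
    then interpret five_cycle c x0 x1 x2 x3 x4 by simp
    show ?cc ?ca ?aa
      using c_c c_A A_A_reduced unfolding S[symmetric] a[symmetric]
      by algebra+
  qed
  have "finite (\<phi> ` ?Z) \<and> card (\<phi> ` ?Z) \<le> 3"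
    by (rule card_le_3_if_quadratics_affine) (fact rels)+
  then show ?thesis
    using inj by (simp add: card_image finite_image_iff)
qed

end
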